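(* Let $\mathcal{A}_i=(A_i,\le_i,\top_i,\odot_i,\to_i,\bot_i)$, $i=1,2$, be two complete residuated multilattices, $G$ and $M$ two non-empty sets, and $(\varphi,\psi)$ a Galois connection between $A_1^G$ and $A_2^M$. Let $$\mathcal{C}=\{(h,f)\in A_1^G\times A_2^M : \varphi(h)=f \text{ and } \psi(f)=h\},$$ ordered by $(h_1,f_1)\le(h_2,f_2)\iff h_1\le_1 h_2$. If $\mathrm{Ext}(\mathcal{C})$ is closed under $\to_1$ and $\mathrm{Int}(\mathcal{C})$ is closed under $\to_2$, then $\mathcal{C}$ is a complete residuated multilattice with the operations $$(h_1,f_1)\odot(h_2,f_2)=(h_1\otimes_1 h_2,\ \varphi(h_1\otimes_1 h_2)),\qquad (h_1,f_1)\rightarrow(h_2,f_2)=(h_1\rightrightarrows_1 h_2,\ \varphi(h_1\rightrightarrows_1 h_2))$$ for all $(h_1,f_1),(h_2,f_2)\in\mathcal{C}$.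
   Context: Let $(P,\le)$ be a poset. For $X\subseteq P$, $\sqcup X$ denotes the set of minimal upper bounds of $X$ and $\sqcap X$ the set of maximal lower bounds of $X$. The poset is a complete multilattice if for all $X\subseteq P$ the sets $\sqcup X,\sqcap X$ are non-empty, each upper bound of $X$ is above ($\ge$) an element of $\sqcup X$, and each lower bound of $X$ is below ($\le$) an element of $\sqcap X$. A pocrim is a structure $(A,\le,\top,\odot,\to)$ where $(A,\le,\top)$ is a poset with greatest element $\top$, $(A,\odot,\top)$ is a commutative monoid, and for all $a,b,c\in A$: $a\odot c\le b\iff c\le a\to b$. A complete residuated multilattice is a pocrim whose underlying poset is a complete multilattice; $\bot$ denotes its least element. $A_1^G$ is the set of all maps $G\to A_1$ and $A_2^M$ the set of all maps $M\to A_2$; the order $\le_i$ and the operations $\odot_i,\to_i$ are defined pointwise on them. A Galois connection between posets $(P,\le)$ and $(Q,\le)$ is a pair of maps $\varphi:P\to Q$, $\psi:Q\to P$ such that $p\le\psi(q)\iff q\le\varphi(p)$ for all $p\in P,q\in Q$. $\mathrm{Ext}(\mathcal{C})=\{h\in A_1^G:\psi\varphi(h)=h\}$ and $\mathrm{Int}(\mathcal{C})=\{f\in A_2^M:\varphi\psi(f)=f\}$. For $h_1,h_2\in A_1^G$: $h_1\otimes_1 h_2:=\psi\varphi(h_1\odot_1 h_2)$ and $h_1\rightrightarrows_1 h_2:=\psi\varphi(h_1\to_1 h_2)$. *)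

theory Defs
  imports "HOL-Algebra.Group"
begin

definition minimal_upper_bounds :: "('a, 'r) gorder_scheme \<Rightarrow> 'a set \<Rightarrow> 'a set" where
  "minimal_upper_bounds L X =
     {u \<in> Upper L X. \<forall>v \<in> Upper L X. v \<sqsubseteq>\<^bsub>L\<^esub> u \<longrightarrow> v = u}"

definition maximal_lower_bounds :: "('a, 'r) gorder_scheme \<Rightarrow> 'a set \<Rightarrow> 'a set" where
  "maximal_lower_bounds L X =
     {l \<in> Lower L X. \<forall>m \<in> Lower L X. l \<sqsubseteq>\<^bsub>L\<^esub> m \<longrightarrow> m = l}"

locale complete_multilattice = partial_order L for L (structure) +
  assumes minimal_upper_bounds_nonempty:
      "X \<subseteq> carrier L \<Longrightarrow> minimal_upper_bounds L X \<noteq> {}"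
    and maximal_lower_bounds_nonempty:
      "X \<subseteq> carrier L \<Longrightarrow> maximal_lower_bounds L X \<noteq> {}"
    and above_minimal_upper_bound:
      "\<lbrakk>X \<subseteq> carrier L; u \<in> Upper L X\<rbrakk> \<Longrightarrow> \<exists>m \<in> minimal_upper_bounds L X. m \<sqsubseteq> u"
    and below_maximal_lower_bound:
      "\<lbrakk>X \<subseteq> carrier L; l \<in> Lower L X\<rbrakk> \<Longrightarrow> \<exists>m \<in> maximal_lower_bounds L X. l \<sqsubseteq> m"

text \<open>
  The greatest and least elements are not stored in the record: they are determined by the
  order and available as \<^const>\<open>Order.top\<close> and \<^const>\<open>Order.bottom\<close>.
\<close>

record 'a residuated = "'a gorder" +
  odot :: "['a, 'a] \<Rightarrow> 'a"  (infixl \<open>\<odot>\<index>\<close> 70)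
  imp  :: "['a, 'a] \<Rightarrow> 'a"  (infixr \<open>\<leadsto>\<index>\<close> 65)

definition top_monoid :: "('a, 'r) residuated_scheme \<Rightarrow> 'a monoid" where
  "top_monoid A = \<lparr>carrier = carrier A, mult = (\<odot>\<^bsub>A\<^esub>), one = \<top>\<^bsub>A\<^esub>\<rparr>"

locale pocrim = partial_order A + weak_partial_order_top A + comm_monoid "top_monoid A" for A (structure) +
  assumes imp_closed: "\<lbrakk>a \<in> carrier A; b \<in> carrier A\<rbrakk> \<Longrightarrow> a \<leadsto> b \<in> carrier A"
    and residuation:
      "\<lbrakk>a \<in> carrier A; b \<in> carrier A; c \<in> carrier A\<rbrakk> \<Longrightarrow> a \<odot> c \<sqsubseteq> b \<longleftrightarrow> c \<sqsubseteq> a \<leadsto> b"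

locale complete_residuated_multilattice = pocrim A + complete_multilattice A for A (structure)

text \<open>
  The power of a structure: maps on the index set are represented as extensional functions, so
  that equality of maps is equality of functions.
\<close>

definition power_structure :: "('a, 'r) residuated_scheme \<Rightarrow> 'i set \<Rightarrow> ('i \<Rightarrow> 'a) residuated" where
  "power_structure A I =
     \<lparr>carrier = I \<rightarrow>\<^sub>E carrier A,
      eq = (=),
      le = (\<lambda>h1 h2. \<forall>i \<in> I. h1 i \<sqsubseteq>\<^bsub>A\<^esub> h2 i),
      odot = (\<lambda>h1 h2. \<lambda>i \<in> I. h1 i \<odot>\<^bsub>A\<^esub> h2 i),
      imp = (\<lambda>h1 h2. \<lambda>i \<in> I. h1 i \<leadsto>\<^bsub>A\<^esub> h2 i)\<rparr>"

text \<open>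
  The antitone notion, in contrast to the isotone connections of \<open>HOL-Algebra\<close>.
\<close>

locale antitone_galois_connection =
  P: partial_order P + Q: partial_order Q
  for P :: "('p, 'r) gorder_scheme" and Q :: "('q, 's) gorder_scheme" +
  fixes \<phi> :: "'p \<Rightarrow> 'q" and \<psi> :: "'q \<Rightarrow> 'p"
  assumes phi_closed: "\<phi> \<in> carrier P \<rightarrow> carrier Q"
    and psi_closed: "\<psi> \<in> carrier Q \<rightarrow> carrier P"
    and galois: "\<lbrakk>p \<in> carrier P; q \<in> carrier Q\<rbrakk> \<Longrightarrow> p \<sqsubseteq>\<^bsub>P\<^esub> \<psi> q \<longleftrightarrow> q \<sqsubseteq>\<^bsub>Q\<^esub> \<phi> p"

definition extents :: "('p, 'r) gorder_scheme \<Rightarrow> ('p \<Rightarrow> 'q) \<Rightarrow> ('q \<Rightarrow> 'p) \<Rightarrow> 'p set" where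
  "extents P \<phi> \<psi> = {h \<in> carrier P. \<psi> (\<phi> h) = h}"

definition intents :: "('q, 's) gorder_scheme \<Rightarrow> ('p \<Rightarrow> 'q) \<Rightarrow> ('q \<Rightarrow> 'p) \<Rightarrow> 'q set" where
  "intents Q \<phi> \<psi> = {f \<in> carrier Q. \<phi> (\<psi> f) = f}"

definition concepts ::
  "('p, 'r) gorder_scheme \<Rightarrow> ('q, 's) gorder_scheme \<Rightarrow> ('p \<Rightarrow> 'q) \<Rightarrow> ('q \<Rightarrow> 'p) \<Rightarrow> ('p \<times> 'q) set" where
  "concepts P Q \<phi> \<psi> = {(h, f). h \<in> carrier P \<and> f \<in> carrier Q \<and> \<phi> h = f \<and> \<psi> f = h}"

definition closed_odot ::
  "('p, 'r) residuated_scheme \<Rightarrow> ('p \<Rightarrow> 'q) \<Rightarrow> ('q \<Rightarrow> 'p) \<Rightarrow> 'p \<Rightarrow> 'p \<Rightarrow> 'p" where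
  "closed_odot P \<phi> \<psi> h1 h2 = \<psi> (\<phi> (h1 \<odot>\<^bsub>P\<^esub> h2))"

definition closed_imp ::
  "('p, 'r) residuated_scheme \<Rightarrow> ('p \<Rightarrow> 'q) \<Rightarrow> ('q \<Rightarrow> 'p) \<Rightarrow> 'p \<Rightarrow> 'p \<Rightarrow> 'p" where
  "closed_imp P \<phi> \<psi> h1 h2 = \<psi> (\<phi> (h1 \<leadsto>\<^bsub>P\<^esub> h2))"

definition concept_structure ::
  "('p, 'r) residuated_scheme \<Rightarrow> ('q, 's) residuated_scheme \<Rightarrow> ('p \<Rightarrow> 'q) \<Rightarrow> ('q \<Rightarrow> 'p)
     \<Rightarrow> ('p \<times> 'q) residuated" where
  "concept_structure P Q \<phi> \<psi> =
     \<lparr>carrier = concepts P Q \<phi> \<psi>,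
      eq = (=),
      le = (\<lambda>(h1, f1) (h2, f2). h1 \<sqsubseteq>\<^bsub>P\<^esub> h2),
      odot = (\<lambda>(h1, f1) (h2, f2). (closed_odot P \<phi> \<psi> h1 h2, \<phi> (closed_odot P \<phi> \<psi> h1 h2))),
      imp = (\<lambda>(h1, f1) (h2, f2). (closed_imp P \<phi> \<psi> h1 h2, \<phi> (closed_imp P \<phi> \<psi> h1 h2)))\<rparr>"

end

theory Submission
  imports Defs
begin

text \<open>
  A concept is determined by its extent, so the concept order is the pointwise order on the
  closed elements of the power of the first structure. It has to be shown that closing up loses
  neither the multilattice structure nor residuation.

  Multilattice part. A maximal lower bound \<open>m\<close> of a set of extents lies below its closure
  \<open>\<psi> (\<phi> m)\<close>, which is again a lower bound because all members of the set are closed; maximality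
  makes \<open>m\<close> an extent (\<open>maximal_lower_bound_closed\<close>). So maximal lower bounds of concepts are
  those of their first components. Since the order on concepts is the reversed order on second
  components, the same argument for the dual connection gives the minimal upper bounds of
  concepts as maximal lower bounds of intents. In a power, maximal lower bounds are formed
  pointwise, by choice.

  Residuation part. For an extent \<open>d\<close>, the closure of \<open>a \<odot> b\<close> lies below \<open>d\<close> iff \<open>a \<odot> b\<close> does, and
  by hypothesis \<open>a \<leadsto> d\<close> is an extent, so it is its own closure. This gives residuation at once.
  Associativity follows because, for every extent \<open>d\<close>, both ways of bracketing a product of three
  extents are below \<open>d\<close> exactly when the unclosed product in the power is
  (\<open>closed_odot_nested_le_iff\<close>).
\<close>

section \<open>Pocrims\<close>

context pocrim
begin

lemma odot_closed: "\<lbrakk>a \<in> carrier A; b \<in> carrier A\<rbrakk> \<Longrightarrow> a \<odot> b \<in> carrier A"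
  using m_closed[of a b] by (simp add: top_monoid_def)

lemma odot_assoc:
  "\<lbrakk>a \<in> carrier A; b \<in> carrier A; c \<in> carrier A\<rbrakk> \<Longrightarrow> (a \<odot> b) \<odot> c = a \<odot> (b \<odot> c)"
  using m_assoc[of a b c] by (simp add: top_monoid_def)

lemma odot_comm: "\<lbrakk>a \<in> carrier A; b \<in> carrier A\<rbrakk> \<Longrightarrow> a \<odot> b = b \<odot> a"
  using m_comm[of a b] by (simp add: top_monoid_def)

lemma top_odot: "a \<in> carrier A \<Longrightarrow> \<top> \<odot> a = a"
  using l_one[of a] by (simp add: top_monoid_def)

end

lemma top_eqI:
  assumes "partial_order L" and "t \<in> carrier L" and "\<And>x. x \<in> carrier L \<Longrightarrow> x \<sqsubseteq>\<^bsub>L\<^esub> t"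
  shows "\<top>\<^bsub>L\<^esub> = t"
proof -
  interpret partial_order L by fact
  have "greatest L t (carrier L)" using assms by (simp add: greatest_def)
  then show ?thesis unfolding top_def
    by (metis greatest_unique someI)
qed

text \<open>
  The monoid inside a pocrim has the chosen greatest element as its unit; naming that element
  \<open>t\<close> reduces the axioms to plain statements about the record.
\<close>

lemma pocrimI:
  assumes po: "partial_order A"
    and t: "t \<in> carrier A" "\<And>x. x \<in> carrier A \<Longrightarrow> x \<sqsubseteq>\<^bsub>A\<^esub> t"
    and closed: "\<And>a b. \<lbrakk>a \<in> carrier A; b \<in> carrier A\<rbrakk> \<Longrightarrow> a \<odot>\<^bsub>A\<^esub> b \<in> carrier A"
    and assoc: "\<And>a b c. \<lbrakk>a \<in> carrier A; b \<in> carrier A; c \<in> carrier A\<rbrakk>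
      \<Longrightarrow> (a \<odot>\<^bsub>A\<^esub> b) \<odot>\<^bsub>A\<^esub> c = a \<odot>\<^bsub>A\<^esub> (b \<odot>\<^bsub>A\<^esub> c)"
    and comm: "\<And>a b. \<lbrakk>a \<in> carrier A; b \<in> carrier A\<rbrakk> \<Longrightarrow> a \<odot>\<^bsub>A\<^esub> b = b \<odot>\<^bsub>A\<^esub> a"
    and unit: "\<And>a. a \<in> carrier A \<Longrightarrow> t \<odot>\<^bsub>A\<^esub> a = a"
    and imp: "\<And>a b. \<lbrakk>a \<in> carrier A; b \<in> carrier A\<rbrakk> \<Longrightarrow> a \<leadsto>\<^bsub>A\<^esub> b \<in> carrier A"
    and residuation: "\<And>a b c. \<lbrakk>a \<in> carrier A; b \<in> carrier A; c \<in> carrier A\<rbrakk>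
      \<Longrightarrow> a \<odot>\<^bsub>A\<^esub> c \<sqsubseteq>\<^bsub>A\<^esub> b \<longleftrightarrow> c \<sqsubseteq>\<^bsub>A\<^esub> a \<leadsto>\<^bsub>A\<^esub> b"
  shows "pocrim A"
proof -
  interpret partial_order A by (rule po)
  have top: "\<top>\<^bsub>A\<^esub> = t" using top_eqI[OF po t] .
  show ?thesis
  proof (intro pocrim.intro weak_partial_order_top.intro weak_partial_order_top_axioms.intro
      pocrim_axioms.intro)
    show "\<exists>x. greatest A x (carrier A)" using t by (auto simp: greatest_def)
    show "comm_monoid (top_monoid A)"
      by (rule comm_monoidI) (auto simp: top_monoid_def top closed assoc unit t(1) intro: comm)
  qed (use po imp residuation in \<open>auto intro: weak_partial_order_axioms\<close>)
qed


section \<open>Powers\<close>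

lemma power_simps [simp]:
  "carrier (power_structure A I) = I \<rightarrow>\<^sub>E carrier A"
  "h1 \<sqsubseteq>\<^bsub>power_structure A I\<^esub> h2 \<longleftrightarrow> (\<forall>i \<in> I. h1 i \<sqsubseteq>\<^bsub>A\<^esub> h2 i)"
  "h1 \<odot>\<^bsub>power_structure A I\<^esub> h2 = (\<lambda>i \<in> I. h1 i \<odot>\<^bsub>A\<^esub> h2 i)"
  "h1 \<leadsto>\<^bsub>power_structure A I\<^esub> h2 = (\<lambda>i \<in> I. h1 i \<leadsto>\<^bsub>A\<^esub> h2 i)"
  by (simp_all add: power_structure_def)

lemma power_pocrim:
  assumes "pocrim A" and "partial_order (power_structure A I)"
  shows "pocrim (power_structure A I)"
proof -
  interpret pocrim A by fact
  show ?thesis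
  proof (rule pocrimI[where t = "\<lambda>i \<in> I. \<top>\<^bsub>A\<^esub>"])
    fix a b c
    assume abc: "a \<in> carrier (power_structure A I)" "b \<in> carrier (power_structure A I)"
      "c \<in> carrier (power_structure A I)"
    then have mem: "a i \<in> carrier A" "b i \<in> carrier A" "c i \<in> carrier A" if "i \<in> I" for i
      using that by auto
    show "(a \<odot>\<^bsub>power_structure A I\<^esub> b) \<odot>\<^bsub>power_structure A I\<^esub> c =
        a \<odot>\<^bsub>power_structure A I\<^esub> (b \<odot>\<^bsub>power_structure A I\<^esub> c)"
      using mem by (auto intro!: restrict_ext simp: odot_assoc)
    show "a \<odot>\<^bsub>power_structure A I\<^esub> c \<sqsubseteq>\<^bsub>power_structure A I\<^esub> b \<longleftrightarrow>
        c \<sqsubseteq>\<^bsub>power_structure A I\<^esub> a \<leadsto>\<^bsub>power_structure A I\<^esub> b"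
      using mem by (simp add: residuation)
  next
    fix a assume "a \<in> carrier (power_structure A I)"
    then have a: "a \<in> I \<rightarrow>\<^sub>E carrier A" by simp
    then have "a i \<in> carrier A" if "i \<in> I" for i using that by auto
    then show "(\<lambda>i \<in> I. \<top>\<^bsub>A\<^esub>) \<odot>\<^bsub>power_structure A I\<^esub> a = a"
      by (intro PiE_ext[OF _ a]) (auto simp: top_odot)
  next
    fix a b assume "a \<in> carrier (power_structure A I)" "b \<in> carrier (power_structure A I)"
    then have mem: "a i \<in> carrier A" "b i \<in> carrier A" if "i \<in> I" for i
      using that by auto
    show "a \<odot>\<^bsub>power_structure A I\<^esub> b = b \<odot>\<^bsub>power_structure A I\<^esub> a"
      using mem by (auto intro!: restrict_ext odot_comm)
    show "a \<odot>\<^bsub>power_structure A I\<^esub> b \<in> carrier (power_structure A I)"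
      "a \<leadsto>\<^bsub>power_structure A I\<^esub> b \<in> carrier (power_structure A I)"
      using mem by (auto simp: odot_closed imp_closed)
  qed (use assms(2) in \<open>auto simp: top_closed intro: top_higher\<close>)
qed

lemma power_maximal_lower_boundI:
  assumes m: "m \<in> I \<rightarrow>\<^sub>E carrier A"
    and max: "\<And>i. i \<in> I \<Longrightarrow> m i \<in> maximal_lower_bounds A ((\<lambda>x. x i) ` X)"
    and X: "X \<subseteq> I \<rightarrow>\<^sub>E carrier A"
  shows "m \<in> maximal_lower_bounds (power_structure A I) X"
  unfolding maximal_lower_bounds_def
proof (intro CollectI conjI ballI impI)
  show "m \<in> Lower (power_structure A I) X"
    using max m X by (fastforce simp: maximal_lower_bounds_def Lower_def)
next
  fix n
  assume n: "n \<in> Lower (power_structure A I) X" and le: "m \<sqsubseteq>\<^bsub>power_structure A I\<^esub> n"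
  have nc: "n \<in> I \<rightarrow>\<^sub>E carrier A" using n by (simp add: Lower_def)
  have "n i = m i" if i: "i \<in> I" for i
  proof -
    have "n i \<in> Lower A ((\<lambda>x. x i) ` X)"
      using n X i PiE_mem[OF nc i] by (auto simp: Lower_def)
    then show ?thesis using max[OF i] le i by (simp add: maximal_lower_bounds_def)
  qed
  with nc m show "n = m" by (rule PiE_ext)
qed

text \<open>
  The half of completeness that concerns lower bounds. Required of both sides of an antitone
  Galois connection it gives full completeness of the concepts, because upper bounds of concepts
  are lower bounds of their intents.
\<close>

definition enough_maximal_lower_bounds :: "('a, 'r) gorder_scheme \<Rightarrow> bool" where
  "enough_maximal_lower_bounds L \<longleftrightarrow>
     (\<forall>X \<subseteq> carrier L. maximal_lower_bounds L X \<noteq> {} \<and>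
        (\<forall>l \<in> Lower L X. \<exists>m \<in> maximal_lower_bounds L X. l \<sqsubseteq>\<^bsub>L\<^esub> m))"

lemma power_enough_maximal_lower_bounds:
  assumes "complete_multilattice A"
  shows "enough_maximal_lower_bounds (power_structure A I)"
  unfolding enough_maximal_lower_bounds_def
proof (intro allI impI conjI ballI)
  interpret complete_multilattice A by fact
  fix X assume "X \<subseteq> carrier (power_structure A I)"
  then have X: "X \<subseteq> I \<rightarrow>\<^sub>E carrier A" by simp
  have proj: "(\<lambda>x. x i) ` X \<subseteq> carrier A" if "i \<in> I" for i
    using X that by auto
  have carr: "m \<in> carrier A" if "m \<in> maximal_lower_bounds A Y" for m Y
    using that by (simp add: maximal_lower_bounds_def Lower_def)
  show "maximal_lower_bounds (power_structure A I) X \<noteq> {}"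
  proof -
    have "\<forall>i \<in> I. \<exists>u. u \<in> maximal_lower_bounds A ((\<lambda>x. x i) ` X)"
      using maximal_lower_bounds_nonempty proj by blast
    then obtain u where "\<forall>i \<in> I. u i \<in> maximal_lower_bounds A ((\<lambda>x. x i) ` X)"
      by metis
    then have "restrict u I \<in> maximal_lower_bounds (power_structure A I) X"
      using X carr by (intro power_maximal_lower_boundI) auto
    then show ?thesis by auto
  qed
  fix l assume l: "l \<in> Lower (power_structure A I) X"
  have "\<forall>i \<in> I. \<exists>u. u \<in> maximal_lower_bounds A ((\<lambda>x. x i) ` X) \<and> l i \<sqsubseteq>\<^bsub>A\<^esub> u"
  proof
    fix i assume i: "i \<in> I"
    have "l i \<in> Lower A ((\<lambda>x. x i) ` X)"
      using l X i by (auto simp: Lower_def)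
    then show "\<exists>u. u \<in> maximal_lower_bounds A ((\<lambda>x. x i) ` X) \<and> l i \<sqsubseteq>\<^bsub>A\<^esub> u"
      using below_maximal_lower_bound[OF proj[OF i]] by blast
  qed
  then obtain u where u: "\<forall>i \<in> I. u i \<in> maximal_lower_bounds A ((\<lambda>x. x i) ` X) \<and> l i \<sqsubseteq>\<^bsub>A\<^esub> u i"
    by metis
  then have "restrict u I \<in> maximal_lower_bounds (power_structure A I) X"
    using X carr by (intro power_maximal_lower_boundI) auto
  moreover have "l \<sqsubseteq>\<^bsub>power_structure A I\<^esub> restrict u I" using u by simp
  ultimately show "\<exists>m \<in> maximal_lower_bounds (power_structure A I) X.
      l \<sqsubseteq>\<^bsub>power_structure A I\<^esub> m" by blast
qed


section \<open>Antitone Galois connections and their concepts\<close>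

context antitone_galois_connection
begin

lemma dual: "antitone_galois_connection Q P \<psi> \<phi>"
proof (intro antitone_galois_connection.intro antitone_galois_connection_axioms.intro)
  show "q \<sqsubseteq>\<^bsub>Q\<^esub> \<phi> p \<longleftrightarrow> p \<sqsubseteq>\<^bsub>P\<^esub> \<psi> q" if "q \<in> carrier Q" "p \<in> carrier P" for q p
    using galois that by blast
qed (rule P.partial_order_axioms Q.partial_order_axioms phi_closed psi_closed)+

lemma phi_carrier: "p \<in> carrier P \<Longrightarrow> \<phi> p \<in> carrier Q"
  using phi_closed by auto

lemma psi_carrier: "q \<in> carrier Q \<Longrightarrow> \<psi> q \<in> carrier P"
  using psi_closed by auto

lemma below_closure: "p \<in> carrier P \<Longrightarrow> p \<sqsubseteq>\<^bsub>P\<^esub> \<psi> (\<phi> p)"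
  using galois[of p "\<phi> p"] phi_carrier Q.le_refl by simp

lemma phi_antitone:
  assumes "p \<in> carrier P" "p' \<in> carrier P" "p \<sqsubseteq>\<^bsub>P\<^esub> p'"
  shows "\<phi> p' \<sqsubseteq>\<^bsub>Q\<^esub> \<phi> p"
proof -
  have "p \<sqsubseteq>\<^bsub>P\<^esub> \<psi> (\<phi> p')"
    by (rule P.le_trans[OF assms(3) below_closure]) (simp_all add: assms phi_carrier psi_carrier)
  then show ?thesis using assms galois[of p "\<phi> p'"] phi_carrier by simp
qed

lemma phi_closure:
  assumes "p \<in> carrier P"
  shows "\<phi> (\<psi> (\<phi> p)) = \<phi> p"
proof (rule Q.le_antisym)
  show "\<phi> (\<psi> (\<phi> p)) \<sqsubseteq>\<^bsub>Q\<^esub> \<phi> p"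
    by (rule phi_antitone[OF assms _ below_closure]) (simp_all add: assms phi_carrier psi_carrier)
  show "\<phi> p \<sqsubseteq>\<^bsub>Q\<^esub> \<phi> (\<psi> (\<phi> p))"
    using galois[of "\<psi> (\<phi> p)" "\<phi> p"] assms phi_carrier psi_carrier P.le_refl by simp
qed (use assms phi_carrier psi_carrier in auto)

lemma extents_carrier: "h \<in> extents P \<phi> \<psi> \<Longrightarrow> h \<in> carrier P"
  by (simp add: extents_def)

lemma closure_extent: "p \<in> carrier P \<Longrightarrow> \<psi> (\<phi> p) \<in> extents P \<phi> \<psi>"
  by (simp add: extents_def phi_closure phi_carrier psi_carrier)

lemma closure_le_extent_iff:
  assumes "p \<in> carrier P" and "h \<in> extents P \<phi> \<psi>"
  shows "\<psi> (\<phi> p) \<sqsubseteq>\<^bsub>P\<^esub> h \<longleftrightarrow> p \<sqsubseteq>\<^bsub>P\<^esub> h"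
proof -
  have h: "h \<in> carrier P" "\<psi> (\<phi> h) = h" using assms(2) by (auto simp: extents_def)
  have "\<psi> (\<phi> p) \<sqsubseteq>\<^bsub>P\<^esub> \<psi> (\<phi> h) \<longleftrightarrow> p \<sqsubseteq>\<^bsub>P\<^esub> \<psi> (\<phi> h)"
    using galois[of p "\<phi> h"] galois[of "\<psi> (\<phi> p)" "\<phi> h"] phi_closure[OF assms(1)]
      assms(1) h(1) phi_carrier psi_carrier by simp
  then show ?thesis by (simp add: h(2))
qed

text \<open>
  Closing a lower bound of extents gives a lower bound that is at least as large, so a maximal
  one cannot grow.
\<close>

lemma maximal_lower_bound_closed:
  assumes X: "X \<subseteq> extents P \<phi> \<psi>" and m: "m \<in> maximal_lower_bounds P X"
  shows "m \<in> extents P \<phi> \<psi>"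
proof -
  have mc: "m \<in> carrier P" using m by (simp add: maximal_lower_bounds_def Lower_def)
  have "\<psi> (\<phi> m) \<in> Lower P X"
    using X m mc closure_le_extent_iff phi_carrier psi_carrier
    by (auto simp: maximal_lower_bounds_def Lower_def)
  then have "\<psi> (\<phi> m) = m"
    using m below_closure[OF mc] by (simp add: maximal_lower_bounds_def)
  then show ?thesis using mc by (simp add: extents_def)
qed

text \<open>An extent is determined by the extents above it, as it is one of them.\<close>

lemma extent_eqI:
  assumes a: "a \<in> extents P \<phi> \<psi>" and b: "b \<in> extents P \<phi> \<psi>"
    and "\<And>d. d \<in> extents P \<phi> \<psi> \<Longrightarrow> a \<sqsubseteq>\<^bsub>P\<^esub> d \<longleftrightarrow> b \<sqsubseteq>\<^bsub>P\<^esub> d"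
  shows "a = b"
proof (rule P.le_antisym)
  show "a \<sqsubseteq>\<^bsub>P\<^esub> b" using assms(3)[OF b] P.le_refl[OF extents_carrier[OF b]] by simp
  show "b \<sqsubseteq>\<^bsub>P\<^esub> a" using assms(3)[OF a] P.le_refl[OF extents_carrier[OF a]] by simp
qed (use a b extents_carrier in auto)

end

lemma concept_simps [simp]:
  "carrier (concept_structure P Q \<phi> \<psi>) = concepts P Q \<phi> \<psi>"
  "c \<sqsubseteq>\<^bsub>concept_structure P Q \<phi> \<psi>\<^esub> d \<longleftrightarrow> fst c \<sqsubseteq>\<^bsub>P\<^esub> fst d"
  "c .=\<^bsub>concept_structure P Q \<phi> \<psi>\<^esub> d \<longleftrightarrow> c = d"
  "c \<odot>\<^bsub>concept_structure P Q \<phi> \<psi>\<^esub> d =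
     (closed_odot P \<phi> \<psi> (fst c) (fst d), \<phi> (closed_odot P \<phi> \<psi> (fst c) (fst d)))"
  "c \<leadsto>\<^bsub>concept_structure P Q \<phi> \<psi>\<^esub> d =
     (closed_imp P \<phi> \<psi> (fst c) (fst d), \<phi> (closed_imp P \<phi> \<psi> (fst c) (fst d)))"
  by (auto simp: concept_structure_def split: prod.splits)

context
  fixes P :: "('p, 'r) residuated_scheme" and Q :: "('q, 's) residuated_scheme"
    and \<phi> :: "'p \<Rightarrow> 'q" and \<psi> :: "'q \<Rightarrow> 'p"
  assumes conn: "antitone_galois_connection P Q \<phi> \<psi>"
begin

interpretation antitone_galois_connection P Q \<phi> \<psi> by (rule conn)

interpretation dual: antitone_galois_connection Q P \<psi> \<phi> by (rule dual)

abbreviation (input) "C \<equiv> concept_structure P Q \<phi> \<psi>"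

lemma concept_extent: "c \<in> concepts P Q \<phi> \<psi> \<Longrightarrow> fst c \<in> extents P \<phi> \<psi>"
  by (auto simp: concepts_def extents_def)

lemma concept_intent: "c \<in> concepts P Q \<phi> \<psi> \<Longrightarrow> snd c \<in> extents Q \<psi> \<phi>"
  by (auto simp: concepts_def extents_def)

lemma extent_concept: "h \<in> extents P \<phi> \<psi> \<Longrightarrow> (h, \<phi> h) \<in> concepts P Q \<phi> \<psi>"
  by (simp add: concepts_def extents_def phi_carrier)

lemma intent_concept: "f \<in> extents Q \<psi> \<phi> \<Longrightarrow> (\<psi> f, f) \<in> concepts P Q \<phi> \<psi>"
  by (simp add: concepts_def extents_def psi_carrier)

lemma concept_carrier:
  assumes "c \<in> concepts P Q \<phi> \<psi>"
  shows "fst c \<in> carrier P" and "snd c \<in> carrier Q"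
  using assms by (auto simp: concepts_def)

lemma concept_order_dual:
  assumes "c \<in> concepts P Q \<phi> \<psi>" and "d \<in> concepts P Q \<phi> \<psi>"
  shows "fst c \<sqsubseteq>\<^bsub>P\<^esub> fst d \<longleftrightarrow> snd d \<sqsubseteq>\<^bsub>Q\<^esub> snd c"
  using assms galois[of "fst c" "snd d"] by (auto simp: concepts_def)

lemma concept_partial_order: "partial_order C"
proof
  fix a b c
  assume "a \<in> carrier C" "b \<in> carrier C" "c \<in> carrier C" "a \<sqsubseteq>\<^bsub>C\<^esub> b" "b \<sqsubseteq>\<^bsub>C\<^esub> c"
  then show "a \<sqsubseteq>\<^bsub>C\<^esub> c"
    using P.le_trans[of "fst a" "fst b" "fst c"] by (auto simp: concepts_def)
next
  fix a b
  assume "a \<in> carrier C" "b \<in> carrier C" "a \<sqsubseteq>\<^bsub>C\<^esub> b" "b \<sqsubseteq>\<^bsub>C\<^esub> a"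
  then show "a .=\<^bsub>C\<^esub> b"
    using P.le_antisym[of "fst a" "fst b"] by (auto simp: concepts_def)
qed (auto simp: concepts_def P.le_refl fun_eq_iff)

lemma Lower_concepts:
  assumes Y: "Y \<subseteq> concepts P Q \<phi> \<psi>"
  shows "c \<in> Lower C Y \<longleftrightarrow> c \<in> concepts P Q \<phi> \<psi> \<and> fst c \<in> Lower P (fst ` Y)"
proof -
  have "c \<in> Lower C Y \<longleftrightarrow> c \<in> concepts P Q \<phi> \<psi> \<and> (\<forall>y \<in> Y. fst c \<sqsubseteq>\<^bsub>P\<^esub> fst y)"
    using Y unfolding Lower_def concept_simps by blast
  also have "\<dots> \<longleftrightarrow> c \<in> concepts P Q \<phi> \<psi> \<and> fst c \<in> Lower P (fst ` Y)"
    using subsetD[OF Y, THEN concept_carrier(1)] concept_carrier(1)[of c] unfolding Lower_def by blast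
  finally show ?thesis .
qed

lemma Upper_concepts:
  assumes Y: "Y \<subseteq> concepts P Q \<phi> \<psi>"
  shows "c \<in> Upper C Y \<longleftrightarrow> c \<in> concepts P Q \<phi> \<psi> \<and> snd c \<in> Lower Q (snd ` Y)"
proof -
  have "c \<in> Upper C Y \<longleftrightarrow> c \<in> concepts P Q \<phi> \<psi> \<and> (\<forall>y \<in> Y. fst y \<sqsubseteq>\<^bsub>P\<^esub> fst c)"
    using Y unfolding Upper_def concept_simps by blast
  also have "\<dots> \<longleftrightarrow> c \<in> concepts P Q \<phi> \<psi> \<and> (\<forall>y \<in> Y. snd c \<sqsubseteq>\<^bsub>Q\<^esub> snd y)"
    using concept_order_dual[OF subsetD[OF Y]] by (intro conj_cong refl ball_cong) auto
  also have "\<dots> \<longleftrightarrow> c \<in> concepts P Q \<phi> \<psi> \<and> snd c \<in> Lower Q (snd ` Y)"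
    using subsetD[OF Y, THEN concept_carrier(2)] concept_carrier(2)[of c] unfolding Lower_def by blast
  finally show ?thesis .
qed

lemma concept_maximal_lower_bound:
  assumes Y: "Y \<subseteq> concepts P Q \<phi> \<psi>" and m: "m \<in> maximal_lower_bounds P (fst ` Y)"
  shows "(m, \<phi> m) \<in> maximal_lower_bounds C Y"
proof -
  have "fst ` Y \<subseteq> extents P \<phi> \<psi>" using Y by (auto intro: concept_extent)
  then have c: "(m, \<phi> m) \<in> concepts P Q \<phi> \<psi>"
    by (intro extent_concept maximal_lower_bound_closed[OF _ m])
  have "v = (m, \<phi> m)" if v: "v \<in> Lower C Y" and le: "(m, \<phi> m) \<sqsubseteq>\<^bsub>C\<^esub> v" for v
  proof -
    have vc: "v \<in> concepts P Q \<phi> \<psi>" "fst v \<in> Lower P (fst ` Y)"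
      using v by (simp_all add: Lower_concepts[OF Y])
    have "fst v = m" using m vc(2) le by (simp add: maximal_lower_bounds_def)
    then show ?thesis using vc(1) by (auto simp: concepts_def)
  qed
  then show ?thesis
    using c m unfolding maximal_lower_bounds_def by (simp add: Lower_concepts[OF Y] del: split_paired_All)
qed

text \<open>The mirror image: the concept order is reversed on intents.\<close>

lemma concept_minimal_upper_bound:
  assumes Y: "Y \<subseteq> concepts P Q \<phi> \<psi>" and f: "f \<in> maximal_lower_bounds Q (snd ` Y)"
  shows "(\<psi> f, f) \<in> minimal_upper_bounds C Y"
proof -
  have "snd ` Y \<subseteq> extents Q \<psi> \<phi>" using Y by (auto intro: concept_intent)
  then have c: "(\<psi> f, f) \<in> concepts P Q \<phi> \<psi>"
    by (intro intent_concept dual.maximal_lower_bound_closed[OF _ f])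
  have "v = (\<psi> f, f)" if v: "v \<in> Upper C Y" and le: "v \<sqsubseteq>\<^bsub>C\<^esub> (\<psi> f, f)" for v
  proof -
    have vc: "v \<in> concepts P Q \<phi> \<psi>" "snd v \<in> Lower Q (snd ` Y)"
      using v by (simp_all add: Upper_concepts[OF Y])
    have "f \<sqsubseteq>\<^bsub>Q\<^esub> snd v" using concept_order_dual[OF vc(1) c] le by simp
    then have "snd v = f" using f vc(2) by (simp add: maximal_lower_bounds_def)
    then show ?thesis using vc(1) by (auto simp: concepts_def)
  qed
  then show ?thesis
    using c f unfolding minimal_upper_bounds_def maximal_lower_bounds_def
    by (simp add: Upper_concepts[OF Y] del: split_paired_All)
qed

lemma concept_complete_multilattice:
  assumes P: "enough_maximal_lower_bounds P" and Q: "enough_maximal_lower_bounds Q"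
  shows "complete_multilattice C"
proof (intro complete_multilattice.intro complete_multilattice_axioms.intro
    concept_partial_order)
  fix Y assume "Y \<subseteq> carrier C"
  then have Y: "Y \<subseteq> concepts P Q \<phi> \<psi>" by simp
  have YP: "fst ` Y \<subseteq> carrier P" and YQ: "snd ` Y \<subseteq> carrier Q"
    using Y concept_carrier by auto
  note mlb = P[unfolded enough_maximal_lower_bounds_def, THEN spec, THEN mp, OF YP]
  note mub = Q[unfolded enough_maximal_lower_bounds_def, THEN spec, THEN mp, OF YQ]
  show "maximal_lower_bounds C Y \<noteq> {}"
    using mlb concept_maximal_lower_bound[OF Y] by blast
  show "minimal_upper_bounds C Y \<noteq> {}"
    using mub concept_minimal_upper_bound[OF Y] by blast
  show "\<exists>m \<in> maximal_lower_bounds C Y. l \<sqsubseteq>\<^bsub>C\<^esub> m" if "l \<in> Lower C Y" for l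
  proof -
    have "fst l \<in> Lower P (fst ` Y)" using that Lower_concepts[OF Y] by simp
    then obtain m where m: "m \<in> maximal_lower_bounds P (fst ` Y)" "fst l \<sqsubseteq>\<^bsub>P\<^esub> m"
      using mlb by blast
    show ?thesis
      by (rule bexI[OF _ concept_maximal_lower_bound[OF Y m(1)]]) (simp add: m(2))
  qed
  show "\<exists>m \<in> minimal_upper_bounds C Y. m \<sqsubseteq>\<^bsub>C\<^esub> u" if "u \<in> Upper C Y" for u
  proof -
    have u: "u \<in> concepts P Q \<phi> \<psi>" "snd u \<in> Lower Q (snd ` Y)"
      using that Upper_concepts[OF Y] by auto
    obtain f where f: "f \<in> maximal_lower_bounds Q (snd ` Y)" "snd u \<sqsubseteq>\<^bsub>Q\<^esub> f"
      using mub u(2) by blast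
    have m: "(\<psi> f, f) \<in> minimal_upper_bounds C Y" by (rule concept_minimal_upper_bound[OF Y f(1)])
    then have "(\<psi> f, f) \<in> concepts P Q \<phi> \<psi>"
      using Upper_concepts[OF Y] by (simp add: minimal_upper_bounds_def)
    then have "\<psi> f \<sqsubseteq>\<^bsub>P\<^esub> fst u" using concept_order_dual[OF _ u(1), of "(\<psi> f, f)"] f(2) by simp
    then show ?thesis by (intro bexI[OF _ m]) simp
  qed
qed


section \<open>Residuation on concepts\<close>

context
  assumes pocrim: "pocrim P"
    and imp_extent: "\<And>a b. \<lbrakk>a \<in> extents P \<phi> \<psi>; b \<in> extents P \<phi> \<psi>\<rbrakk> \<Longrightarrow> a \<leadsto>\<^bsub>P\<^esub> b \<in> extents P \<phi> \<psi>"
begin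

interpretation R: pocrim P by (rule pocrim)

lemma closed_imp_eq:
  assumes "a \<in> extents P \<phi> \<psi>" "b \<in> extents P \<phi> \<psi>"
  shows "closed_imp P \<phi> \<psi> a b = a \<leadsto>\<^bsub>P\<^esub> b"
  using imp_extent[OF assms] by (simp add: closed_imp_def extents_def)

lemma closed_odot_extent:
  assumes "a \<in> extents P \<phi> \<psi>" "b \<in> extents P \<phi> \<psi>"
  shows "closed_odot P \<phi> \<psi> a b \<in> extents P \<phi> \<psi>"
  using assms by (simp add: closed_odot_def closure_extent extents_carrier R.odot_closed)

lemma closed_odot_le_iff:
  assumes "a \<in> extents P \<phi> \<psi>" "b \<in> extents P \<phi> \<psi>" "d \<in> extents P \<phi> \<psi>"
  shows "closed_odot P \<phi> \<psi> a b \<sqsubseteq>\<^bsub>P\<^esub> d \<longleftrightarrow> a \<odot>\<^bsub>P\<^esub> b \<sqsubseteq>\<^bsub>P\<^esub> d"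
  using assms by (simp add: closed_odot_def closure_le_extent_iff extents_carrier R.odot_closed)

lemma closed_odot_comm:
  assumes "a \<in> extents P \<phi> \<psi>" "b \<in> extents P \<phi> \<psi>"
  shows "closed_odot P \<phi> \<psi> a b = closed_odot P \<phi> \<psi> b a"
  using assms by (simp add: closed_odot_def extents_carrier R.odot_comm)

text \<open>
  Moving \<open>a\<close> to the right-hand side leaves the extent \<open>a \<leadsto> d\<close> there, so the closure of the
  inner product can be dropped before \<open>a\<close> is moved back.
\<close>

lemma closed_odot_nested_le_iff:
  assumes "a \<in> extents P \<phi> \<psi>" "b \<in> extents P \<phi> \<psi>" "c \<in> extents P \<phi> \<psi>" "d \<in> extents P \<phi> \<psi>"
  shows "closed_odot P \<phi> \<psi> a (closed_odot P \<phi> \<psi> b c) \<sqsubseteq>\<^bsub>P\<^esub> d \<longleftrightarrow>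
    a \<odot>\<^bsub>P\<^esub> (b \<odot>\<^bsub>P\<^esub> c) \<sqsubseteq>\<^bsub>P\<^esub> d"
proof -
  have "closed_odot P \<phi> \<psi> a (closed_odot P \<phi> \<psi> b c) \<sqsubseteq>\<^bsub>P\<^esub> d \<longleftrightarrow>
      closed_odot P \<phi> \<psi> b c \<sqsubseteq>\<^bsub>P\<^esub> a \<leadsto>\<^bsub>P\<^esub> d"
    using assms by (simp add: closed_odot_le_iff closed_odot_extent R.residuation extents_carrier)
  also have "\<dots> \<longleftrightarrow> b \<odot>\<^bsub>P\<^esub> c \<sqsubseteq>\<^bsub>P\<^esub> a \<leadsto>\<^bsub>P\<^esub> d"
    using assms by (simp add: closed_odot_le_iff imp_extent)
  also have "\<dots> \<longleftrightarrow> a \<odot>\<^bsub>P\<^esub> (b \<odot>\<^bsub>P\<^esub> c) \<sqsubseteq>\<^bsub>P\<^esub> d"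
    using assms by (simp add: R.residuation R.odot_closed extents_carrier)
  finally show ?thesis .
qed

text \<open>
  By commutativity every bracketing has the nested form just treated, so the extents above it
  are those above the unclosed product.
\<close>

lemma closed_odot_assoc:
  assumes a: "a \<in> extents P \<phi> \<psi>" and b: "b \<in> extents P \<phi> \<psi>" and c: "c \<in> extents P \<phi> \<psi>"
  shows "closed_odot P \<phi> \<psi> (closed_odot P \<phi> \<psi> a b) c =
    closed_odot P \<phi> \<psi> a (closed_odot P \<phi> \<psi> b c)"
proof (rule extent_eqI)
  fix d assume d: "d \<in> extents P \<phi> \<psi>"
  have "closed_odot P \<phi> \<psi> (closed_odot P \<phi> \<psi> a b) c = closed_odot P \<phi> \<psi> c (closed_odot P \<phi> \<psi> a b)"
    using a b c by (simp add: closed_odot_comm closed_odot_extent)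
  moreover have "c \<odot>\<^bsub>P\<^esub> (a \<odot>\<^bsub>P\<^esub> b) = a \<odot>\<^bsub>P\<^esub> (b \<odot>\<^bsub>P\<^esub> c)"
    using a b c by (metis R.odot_assoc R.odot_comm R.odot_closed extents_carrier)
  ultimately show "closed_odot P \<phi> \<psi> (closed_odot P \<phi> \<psi> a b) c \<sqsubseteq>\<^bsub>P\<^esub> d \<longleftrightarrow>
      closed_odot P \<phi> \<psi> a (closed_odot P \<phi> \<psi> b c) \<sqsubseteq>\<^bsub>P\<^esub> d"
    using closed_odot_nested_le_iff a b c d by simp
qed (use a b c closed_odot_extent in auto)

lemma top_extent: "\<top>\<^bsub>P\<^esub> \<in> extents P \<phi> \<psi>"
proof -
  have "\<psi> (\<phi> \<top>\<^bsub>P\<^esub>) = \<top>\<^bsub>P\<^esub>"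
    by (rule P.le_antisym[OF R.top_higher below_closure])
      (simp_all add: R.top_closed phi_carrier psi_carrier)
  then show ?thesis by (simp add: extents_def R.top_closed)
qed

lemma concept_pocrim: "pocrim C"
proof (rule pocrimI[where t = "(\<top>\<^bsub>P\<^esub>, \<phi> \<top>\<^bsub>P\<^esub>)"])
  fix a b c assume "a \<in> carrier C" "b \<in> carrier C" "c \<in> carrier C"
  then have abc: "fst a \<in> extents P \<phi> \<psi>" "fst b \<in> extents P \<phi> \<psi>" "fst c \<in> extents P \<phi> \<psi>"
    by (simp_all add: concept_extent)
  then show "(a \<odot>\<^bsub>C\<^esub> b) \<odot>\<^bsub>C\<^esub> c = a \<odot>\<^bsub>C\<^esub> (b \<odot>\<^bsub>C\<^esub> c)"
    by (simp add: closed_odot_assoc)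
  show "a \<odot>\<^bsub>C\<^esub> c \<sqsubseteq>\<^bsub>C\<^esub> b \<longleftrightarrow> c \<sqsubseteq>\<^bsub>C\<^esub> a \<leadsto>\<^bsub>C\<^esub> b"
    using abc by (simp add: closed_odot_le_iff closed_imp_eq R.residuation extents_carrier)
next
  fix a b assume "a \<in> carrier C" "b \<in> carrier C"
  then have ab: "fst a \<in> extents P \<phi> \<psi>" "fst b \<in> extents P \<phi> \<psi>"
    by (simp_all add: concept_extent)
  then show "a \<odot>\<^bsub>C\<^esub> b \<in> carrier C" by (simp add: extent_concept closed_odot_extent)
  show "a \<odot>\<^bsub>C\<^esub> b = b \<odot>\<^bsub>C\<^esub> a" using ab by (simp add: closed_odot_comm)
  show "a \<leadsto>\<^bsub>C\<^esub> b \<in> carrier C" using ab by (simp add: extent_concept closed_imp_eq imp_extent)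
next
  fix a assume "a \<in> carrier C"
  then show "(\<top>\<^bsub>P\<^esub>, \<phi> \<top>\<^bsub>P\<^esub>) \<odot>\<^bsub>C\<^esub> a = a"
    by (cases a) (auto simp: concepts_def closed_odot_def R.top_odot)
next
  fix c assume "c \<in> carrier C"
  then show "c \<sqsubseteq>\<^bsub>C\<^esub> (\<top>\<^bsub>P\<^esub>, \<phi> \<top>\<^bsub>P\<^esub>)"
    using R.top_higher concept_carrier(1) by simp
qed (use concept_partial_order extent_concept[OF top_extent] in simp_all)

end

end

theorem theorem4p3:
  fixes A1 :: "('a, 'r) residuated_scheme" and A2 :: "('b, 's) residuated_scheme"
    and G :: "'g set" and M :: "'m set"
    and \<phi> :: "('g \<Rightarrow> 'a) \<Rightarrow> ('m \<Rightarrow> 'b)" and \<psi> :: "('m \<Rightarrow> 'b) \<Rightarrow> ('g \<Rightarrow> 'a)"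
  assumes "complete_residuated_multilattice A1"
    and "complete_residuated_multilattice A2"
    and "G \<noteq> {}" and "M \<noteq> {}"
    and "antitone_galois_connection (power_structure A1 G) (power_structure A2 M) \<phi> \<psi>"
    and "\<forall>h1 \<in> extents (power_structure A1 G) \<phi> \<psi>. \<forall>h2 \<in> extents (power_structure A1 G) \<phi> \<psi>.
           h1 \<leadsto>\<^bsub>power_structure A1 G\<^esub> h2 \<in> extents (power_structure A1 G) \<phi> \<psi>"
    and "\<forall>f1 \<in> intents (power_structure A2 M) \<phi> \<psi>. \<forall>f2 \<in> intents (power_structure A2 M) \<phi> \<psi>.
           f1 \<leadsto>\<^bsub>power_structure A2 M\<^esub> f2 \<in> intents (power_structure A2 M) \<phi> \<psi>"
  shows "complete_residuated_multilattice
           (concept_structure (power_structure A1 G) (power_structure A2 M) \<phi> \<psi>)"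
proof -
  let ?P = "power_structure A1 G" and ?Q = "power_structure A2 M"
  interpret A1: complete_residuated_multilattice A1 by fact
  interpret A2: complete_residuated_multilattice A2 by fact
  interpret antitone_galois_connection ?P ?Q \<phi> \<psi> by fact
  have "pocrim ?P"
    by (rule power_pocrim[OF A1.pocrim_axioms P.partial_order_axioms])
  then have "pocrim (concept_structure ?P ?Q \<phi> \<psi>)"
    by (rule concept_pocrim[OF assms(5)]) (rule assms(6)[rule_format])
  moreover have "complete_multilattice (concept_structure ?P ?Q \<phi> \<psi>)"
    by (rule concept_complete_multilattice[OF assms(5)
        power_enough_maximal_lower_bounds[OF A1.complete_multilattice_axioms]
        power_enough_maximal_lower_bounds[OF A2.complete_multilattice_axioms]])
  ultimately show ?thesis
    by (rule complete_residuated_multilattice.intro)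
qed

end
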